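(* Consider the sparse Bayesian classification model described in the context. If the Jeffreys' prior is assumed on $\lambda=(\lambda_0,\dots,\lambda_n)^T$, that is, $\pi(\lambda)\propto\prod_{i=0}^n\lambda_i^{-1}$ on $(0,\infty)^{n+1}$, then the posterior density $\pi(\beta,z,\sigma^2,\lambda,\theta\mid y)$ of the parameters and latent variables is improper, i.e. its normalizing constant $$\int_{u_1}^{u_2}\int_{(0,\infty)^{n+1}}\int_0^\infty\int_{\mathbb{R}^n}\int_{\mathbb{R}^{n+1}} f(y\mid z)\,f(z\mid\beta,\sigma^2,\theta)\,\pi(\beta\mid\lambda,\sigma^2)\,\pi(\lambda)\,\pi(\sigma^2)\,\pi(\theta)\,d\beta\,dz\,d\sigma^2\,d\lambda\,d\theta$$ equals $+\infty$.
   Context: Data: $(y_i,x_i)$, $i=1,\dots,n$, with $y_i\in\{0,1\}$, $x_i\in\mathbb{R}^p$; $y=(y_1,\dots,y_n)^T$. $z=(z_1,\dots,z_n)^T\in\mathbb{R}^n$ is a vector of latent variables, $\beta=(\beta_0,\dots,\beta_n)^T\in\mathbb{R}^{n+1}$, and $D=\mathrm{diag}(\lambda_0,\dots,\lambda_n)$. For each value of the kernel parameter $\theta$, $k_\theta(\cdot,\cdot)$ is a (real-valued) reproducing kernel, and $K=K(\theta)$ is the $n\times(n+1)$ matrix whose $i$-th row is $\big(1,k_\theta(x_i,x_1),\dots,k_\theta(x_i,x_n)\big)$. The function $l(\cdot,\cdot)$ is a (real-valued) loss function, and $c,d,u_1,u_2$ are user-defined hyperparameters ($u_1<u_2$). The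 model, with the Jeffreys' prior on $\lambda$ (in which $\lambda_0$ also receives a prior), is: $$f(y\mid z)\propto\exp\Big\{-\sum_{i=1}^n l(y_i,z_i)\Big\},\qquad z\mid\beta,\sigma^2,\theta\sim N(K\beta,\sigma^2I),\qquad \beta\mid\lambda,\sigma^2\sim N(0,\sigma^2D^{-1}),$$ $$\pi(\lambda)\propto\prod_{i=0}^n\lambda_i^{-1},\qquad \sigma^2\sim IG(c,d),\qquad \theta\sim U(u_1,u_2).$$ Here $f(y\mid z)$ is a strictly positive likelihood; $f(z\mid\beta,\sigma^2,\theta)$ and $\pi(\beta\mid\lambda,\sigma^2)$ are the indicated normal densities; $IG(c,d)$ has density $\propto x^{-c-1}e^{-d/x}$ on $x>0$; $U(u_1,u_2)$ is the uniform distribution on $(u_1,u_2)$. The parameters $\lambda$, $\sigma^2$, $\theta$ are a priori independent. $l$ and $\theta\mapsto k_\theta(x_i,x_j)$ are assumed measurable so that the integrals make sense. The posterior density is the product of these factors divided by its integral over all of $(\beta,z,\sigma^2,\lambda,\theta)$; it is called improper if that integral is infinite. *)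

theory Defs
  imports "HOL-Probability.Probability"
begin

text \<open>
  A real Hilbert space whose elements are functions on \<open>'a\<close>, given by its carrier \<open>H\<close> and its
  inner product \<open>ip\<close> (only the values of \<open>ip\<close> on \<open>H\<close> matter).
\<close>

definition hilbert_function_space ::
  "('a \<Rightarrow> real) set \<Rightarrow> (('a \<Rightarrow> real) \<Rightarrow> ('a \<Rightarrow> real) \<Rightarrow> real) \<Rightarrow> bool" where
  "hilbert_function_space H ip \<longleftrightarrow>
     (\<lambda>_. 0) \<in> H \<and>
     (\<forall>f\<in>H. \<forall>g\<in>H. (\<lambda>t. f t + g t) \<in> H) \<and>
     (\<forall>a. \<forall>f\<in>H. (\<lambda>t. a * f t) \<in> H) \<and>
     (\<forall>f\<in>H. \<forall>g\<in>H. ip f g = ip g f) \<and>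
     (\<forall>f\<in>H. \<forall>g\<in>H. \<forall>h\<in>H. ip (\<lambda>t. f t + g t) h = ip f h + ip g h) \<and>
     (\<forall>a. \<forall>f\<in>H. \<forall>g\<in>H. ip (\<lambda>t. a * f t) g = a * ip f g) \<and>
     (\<forall>f\<in>H. 0 \<le> ip f f) \<and>
     (\<forall>f\<in>H. ip f f = 0 \<longrightarrow> f = (\<lambda>_. 0)) \<and>
     Metric_space.mcomplete H (\<lambda>f g. sqrt (ip (\<lambda>t. f t - g t) (\<lambda>t. f t - g t)))"

definition reproducing_kernel :: "('a \<Rightarrow> 'a \<Rightarrow> real) \<Rightarrow> bool" where
  "reproducing_kernel k \<longleftrightarrow>
     (\<exists>H ip. hilbert_function_space H ip \<and>
        (\<forall>s. (\<lambda>t. k t s) \<in> H \<and> (\<forall>f\<in>H. f s = ip f (\<lambda>t. k t s))))"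

text \<open>
  For a sample indexed by \<open>'n\<close>, the index set \<open>{0, \<dots>, n}\<close> of \<open>\<beta>\<close> and \<open>\<lambda>\<close> is \<open>'n option\<close>: \<open>None\<close> is
  the index \<open>0\<close> of the intercept and \<open>Some j\<close> is the index of the \<open>j\<close>-th observation.
\<close>

definition kernel_matrix ::
  "('a \<Rightarrow> 'a \<Rightarrow> real) \<Rightarrow> ('n::finite \<Rightarrow> 'a) \<Rightarrow> real ^ ('n option) ^ 'n" where
  "kernel_matrix k x = (\<chi> i j. case j of None \<Rightarrow> 1 | Some m \<Rightarrow> k (x i) (x m))"

definition diag_matrix :: "real ^ 'm \<Rightarrow> real ^ 'm ^ 'm" where
  "diag_matrix v = (\<chi> i j. if i = j then v $ i else 0)"

text \<open>The covariance matrix \<open>\<Sigma>\<close> is meant to be symmetric positive definite.\<close>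

definition mvn_density :: "real ^ 'm \<Rightarrow> real ^ 'm ^ 'm \<Rightarrow> real ^ 'm \<Rightarrow> real" where
  "mvn_density \<mu> \<Sigma> v =
     exp (- ((v - \<mu>) \<bullet> (matrix_inv \<Sigma> *v (v - \<mu>))) / 2) / sqrt ((2 * pi) ^ CARD('m) * det \<Sigma>)"

text \<open>
  The factor \<open>C z > 0\<close> is the constant hidden in \<open>f(y|z) \<propto> exp {- \<Sum>\<^sub>i l(y\<^sub>i, z\<^sub>i)}\<close>. It may depend on
  \<open>z\<close>, as it does when the right-hand side is normalized as a density in \<open>y\<close>; a constant \<open>C\<close>
  gives the pseudo-likelihood reading.
\<close>

definition likelihood ::
  "(real ^ 'n \<Rightarrow> real) \<Rightarrow> (real \<Rightarrow> real \<Rightarrow> real) \<Rightarrow> real ^ 'n \<Rightarrow> real ^ 'n \<Rightarrow> real" where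
  "likelihood C l y z = C z * exp (- (\<Sum>i\<in>UNIV. l (y $ i) (z $ i)))"

text \<open>The Jeffreys prior is improper, so its proportionality constant \<open>A\<close> is arbitrary.\<close>

definition jeffreys_prior :: "real \<Rightarrow> real ^ 'm \<Rightarrow> real" where
  "jeffreys_prior A lam = A * (\<Prod>i\<in>UNIV. inverse (lam $ i))"

definition inverse_gamma_density :: "real \<Rightarrow> real \<Rightarrow> real \<Rightarrow> real" where
  "inverse_gamma_density c d s =
     (if 0 < s then d powr c / Gamma c * s powr (- c - 1) * exp (- d / s) else 0)"

definition uniform_density :: "real \<Rightarrow> real \<Rightarrow> real \<Rightarrow> real" where
  "uniform_density u1 u2 t = (if t \<in> {u1<..<u2} then 1 / (u2 - u1) else 0)"

end

theory Submission
  imports Defs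
begin

text \<open>
  The posterior is improper because of its behaviour as all components of \<open>\<lambda>\<close> tend to infinity.
  There the prior of \<open>\<beta>\<close> concentrates at \<open>0\<close>, so the data do not penalise large \<open>\<lambda>\<close>: after
  \<open>\<beta>\<close>, \<open>z\<close> and \<open>\<sigma>\<^sup>2\<close> have been integrated out, the marginal likelihood of \<open>\<lambda>\<close> stays above a positive
  constant on the region where every \<open>\<lambda>\<^sub>i \<ge> 1\<close>. The Jeffreys prior has infinite mass on that region
  (\<open>nn_integral_prod_inverse_eq_top\<close>), so the integral over \<open>\<lambda>\<close> diverges for every single \<open>\<theta>\<close>.

  For the lower bound, \<open>\<sigma>\<^sup>2\<close> is restricted to \<open>[1, 2]\<close> and \<open>\<beta>\<close> to the box
  \<open>\<bar>\<beta>\<^sub>i\<bar> \<le> \<lambda>\<^sub>i\<^sup>-\<^sup>1\<^sup>/\<^sup>2\<close>, whose sides are comparable to the prior standard deviations. The box captures a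
  share of the prior mass of \<open>\<beta>\<close> that is bounded below independently of \<open>\<lambda>\<close>
  (\<open>box_density_times_volume\<close>).
  It lies in the unit cube, so \<open>K\<beta>\<close> is bounded there, and the density of \<open>z\<close> dominates a fixed
  positive function of \<open>z\<close> alone. The integral of that function against the likelihood is positive
  (possibly infinite) because the likelihood is positive and measurable.
\<close>

section \<open>Normal densities with diagonal covariance\<close>

lemma mat_1_eq_diag_matrix: "mat 1 = diag_matrix (\<chi> i. 1)"
  by (simp add: mat_def diag_matrix_def vec_eq_iff)

lemma scaleR_diag_matrix: "a *\<^sub>R diag_matrix v = diag_matrix (\<chi> i. a * v $ i)"
  by (simp add: diag_matrix_def vec_eq_iff)

lemma diag_matrix_mult_vec: "diag_matrix v *v w = (\<chi> i. v $ i * w $ i)"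
  by (simp add: diag_matrix_def matrix_vector_mult_def vec_eq_iff if_distrib[of "\<lambda>a. a * _"]
      cong: if_cong)

lemma det_diag_matrix: "det (diag_matrix v) = (\<Prod>i\<in>UNIV. v $ i)"
  by (subst det_diagonal) (simp_all add: diag_matrix_def)

lemma diag_matrix_mult: "diag_matrix v ** diag_matrix w = diag_matrix (\<chi> i. v $ i * w $ i)"
  by (simp add: matrix_eq matrix_vector_mul_assoc[symmetric] diag_matrix_mult_vec mult.assoc)

lemma matrix_inv_unique:
  fixes M :: "'a::semiring_1 ^ 'n ^ 'm"
  assumes "M ** M' = mat 1" and "M' ** M = mat 1"
  shows "matrix_inv M = M'"
  unfolding matrix_inv_def
proof (rule some_equality)
  fix M'' assume "M ** M'' = mat 1 \<and> M'' ** M = mat 1"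
  then show "M'' = M'"
    using assms by (metis matrix_mul_assoc matrix_mul_rid matrix_mul_lid)
qed (use assms in simp)

lemma matrix_inv_diag_matrix:
  assumes "\<And>i. v $ i \<noteq> 0"
  shows "matrix_inv (diag_matrix v) = diag_matrix (\<chi> i. inverse (v $ i))"
  by (rule matrix_inv_unique) (simp_all add: diag_matrix_mult mat_1_eq_diag_matrix assms)

lemma mvn_density_diag_matrix:
  assumes "\<And>i. s $ i \<noteq> 0"
  shows "mvn_density \<mu> (diag_matrix s) (v :: real ^ 'm) =
    exp (- (\<Sum>i\<in>UNIV. (v $ i - \<mu> $ i)\<^sup>2 / s $ i) / 2) /
      sqrt ((2 * pi) ^ CARD('m) * (\<Prod>i\<in>UNIV. s $ i))"
proof -
  have "(v - \<mu>) \<bullet> (matrix_inv (diag_matrix s) *v (v - \<mu>)) =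
      (\<Sum>i\<in>UNIV. (v $ i - \<mu> $ i)\<^sup>2 / s $ i)"
    by (simp add: matrix_inv_diag_matrix assms diag_matrix_mult_vec inner_vec_def
        power2_eq_square divide_inverse mult_ac)
  then show ?thesis
    by (simp add: mvn_density_def det_diag_matrix)
qed

text \<open>
  Bounding the variances by \<open>t\<close> only in the determinant and the quadratic form by \<open>q\<close> separates the two
  effects of the variances on the density, which pull in opposite directions.
\<close>
lemma mvn_density_diag_matrix_ge:
  fixes v :: "real ^ 'm"
  assumes "\<And>i. 0 < s $ i" and "\<And>i. s $ i \<le> t i"
    and "(\<Sum>i\<in>UNIV. (v $ i - \<mu> $ i)\<^sup>2 / s $ i) \<le> q"
  shows "exp (- q / 2) / sqrt ((2 * pi) ^ CARD('m) * (\<Prod>i\<in>UNIV. t i))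
    \<le> mvn_density \<mu> (diag_matrix s) v"
proof -
  have "s $ i \<noteq> 0" for i
    using assms(1)[of i] by simp
  moreover have "0 < (\<Prod>i\<in>UNIV. s $ i)"
    using assms(1) by (intro prod_pos) auto
  moreover have "(\<Prod>i\<in>UNIV. s $ i) \<le> (\<Prod>i\<in>UNIV. t i)"
    using assms(1,2) by (intro prod_mono) (auto intro: less_imp_le)
  ultimately show ?thesis
    using assms(3) by (subst mvn_density_diag_matrix) (auto intro!: frac_le mult_left_mono)
qed

section \<open>Infinite mass of the Jeffreys prior\<close>

lemma emeasure_lborel_cbox_cart:
  fixes a b :: "real ^ 'm"
  assumes "\<And>i. a $ i \<le> b $ i"
  shows "emeasure lborel (cbox a b) = ennreal (\<Prod>i\<in>UNIV. b $ i - a $ i)"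
proof -
  have "cbox a b \<noteq> {}"
    using assms by (auto simp: interval_ne_empty_cart)
  then have "measure lborel (cbox a b) = (\<Prod>i\<in>UNIV. b $ i - a $ i)"
    by (rule content_cbox_cart)
  moreover have "emeasure lborel (cbox a b) = ennreal (measure lborel (cbox a b))"
    using emeasure_lborel_cbox_finite[of a b] by (intro emeasure_eq_ennreal_measure) auto
  ultimately show ?thesis
    by simp
qed

text \<open>
  The measure \<open>\<Prod>\<^sub>i d\<lambda>\<^sub>i / \<lambda>\<^sub>i\<close> is invariant under scaling, so the cubes \<open>[4\<^sup>m, 2 \<cdot> 4\<^sup>m]\<^sup>N\<close> all have the same
  positive mass. They are pairwise disjoint, and there are infinitely many of them.
\<close>
lemma nn_integral_prod_inverse_eq_top:
  "(\<integral>\<^sup>+lam\<in>{lam :: real ^ 'm. \<forall>i. 1 \<le> lam $ i}.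
     ennreal (\<Prod>i\<in>UNIV. inverse (lam $ i)) \<partial>lborel) = \<infinity>"
proof -
  define Q :: "nat \<Rightarrow> (real ^ 'm) set" where "Q m = cbox (\<chi> i. 4 ^ m) (\<chi> i. 2 * 4 ^ m)" for m
  define r :: real where "r = (1 / 2) ^ CARD('m)"
  define w :: "nat \<Rightarrow> real" where "w m = inverse (2 * 4 ^ m) ^ CARD('m)" for m
  have disjoint: "disjoint_family Q"
  proof -
    have "Q m \<inter> Q m' = {}" if "m < m'" for m m'
    proof (rule ccontr)
      assume "Q m \<inter> Q m' \<noteq> {}"
      then obtain lam where "lam \<in> Q m" "lam \<in> Q m'"
        by auto
      then have "(4::real) ^ m' \<le> 2 * 4 ^ m"
        unfolding Q_def mem_box_cart by (force intro: order_trans)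
      moreover have "(4::real) ^ Suc m \<le> 4 ^ m'"
        using that by (intro power_increasing) auto
      moreover have "(0::real) < 4 ^ m"
        by simp
      ultimately show False
        unfolding power_Suc by linarith
    qed
    then show ?thesis
      unfolding disjoint_family_on_def by (metis Int_commute linorder_neqE_nat)
  qed
  have mass: "ennreal (w m) * emeasure lborel (Q m) = ennreal r" for m
    unfolding Q_def by (subst emeasure_lborel_cbox_cart)
      (simp_all add: w_def r_def ennreal_mult[symmetric] power_mult_distrib[symmetric])
  have "(\<Sum>m. ennreal (w m) * indicator (Q m) lam)
      \<le> ennreal (\<Prod>i\<in>UNIV. inverse (lam $ i)) * indicator {lam. \<forall>i. 1 \<le> lam $ i} lam" for lam
  proof (cases "\<exists>m. lam \<in> Q m")
    case True
    then obtain m where m: "lam \<in> Q m"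
      by auto
    have ge: "4 ^ m \<le> lam $ i" and le: "lam $ i \<le> 2 * 4 ^ m" for i
      using m by (auto simp: Q_def mem_box_cart)
    have ge1: "1 \<le> lam $ i" for i
      using ge[of i] by (rule order_trans[rotated]) simp
    have "m' = m" if "lam \<in> Q m'" for m'
      using disjoint m that unfolding disjoint_family_on_def by blast
    then have "(\<Sum>m'. ennreal (w m') * indicator (Q m') lam) =
        (\<Sum>m'\<in>{m}. ennreal (w m') * indicator (Q m') lam)"
      by (intro suminf_finite) (auto simp: indicator_def)
    also have "\<dots> = ennreal (\<Prod>i\<in>(UNIV::'m set). inverse (2 * 4 ^ m))"
      using m by (simp add: w_def)
    also have "\<dots> \<le> ennreal (\<Prod>i\<in>UNIV. inverse (lam $ i))"
    proof (intro ennreal_leI prod_mono conjI)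
      fix i
      show "inverse (2 * 4 ^ m) \<le> inverse (lam $ i)"
        using le[of i] ge1[of i] by (intro le_imp_inverse_le) linarith+
    qed simp
    finally show ?thesis
      using ge1 by simp
  next
    case False
    then show ?thesis
      by simp
  qed
  then have "(\<integral>\<^sup>+lam. (\<Sum>m. ennreal (w m) * indicator (Q m) lam) \<partial>lborel) \<le>
     (\<integral>\<^sup>+lam\<in>{lam :: real ^ 'm. \<forall>i. 1 \<le> lam $ i}.
       ennreal (\<Prod>i\<in>UNIV. inverse (lam $ i)) \<partial>lborel)"
    by (intro nn_integral_mono)
  moreover have "(\<integral>\<^sup>+lam. (\<Sum>m. ennreal (w m) * indicator (Q m) lam) \<partial>lborel) =
      (\<Sum>m::nat. ennreal r)"
    by (subst nn_integral_suminf) (simp_all add: Q_def nn_integral_cmult_indicator mass[unfolded Q_def])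
  moreover have "(\<Sum>m::nat. ennreal r) = \<infinity>"
  proof (rule ccontr)
    assume "\<not> ?thesis"
    then have "summable (\<lambda>m::nat. r)"
      by (intro summable_suminf_not_top) (auto simp: r_def)
    then show False
      by (simp add: summable_const_iff r_def)
  qed
  ultimately show ?thesis
    by (simp add: top_unique)
qed

section \<open>Lower bounds for the factors of the posterior\<close>

lemma inverse_gamma_density_ge:
  assumes "0 < c" "0 < d" "s \<in> {1..2}"
  shows "d powr c / Gamma c * 2 powr (- c - 1) * exp (- d) \<le> inverse_gamma_density c d s"
proof -
  have "2 powr (- c - 1) \<le> s powr (- c - 1)"
    using assms by (intro powr_mono2') auto
  moreover have "d / s \<le> d"
    using assms by (simp add: field_simps)
  moreover have "0 < Gamma c"
    using assms by (intro Gamma_real_pos)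
  ultimately show ?thesis
    using assms unfolding inverse_gamma_density_def
    by (subst if_P) (auto intro!: mult_mono divide_right_mono)
qed

text \<open>
  The first factor has the form of the lower bound in \<open>mvn_density_diag_matrix_ge\<close> for covariances
  \<open>\<sigma>\<^sup>2 D\<^sup>-\<^sup>1\<close> with \<open>\<sigma>\<^sup>2 \<le> 2\<close>, where \<open>e\<close> is the exponential. The second factor is the volume of the box with
  half-widths \<open>\<lambda>\<^sub>i\<^sup>-\<^sup>1\<^sup>/\<^sup>2\<close>. The powers of \<open>\<lambda>\<close> cancel because these half-widths are proportional to the
  prior standard deviations.
\<close>
lemma box_density_times_volume:
  fixes lam :: "real ^ 'm"
  assumes "\<And>i. 0 < lam $ i"
  shows "e / sqrt ((2 * pi) ^ CARD('m) * (\<Prod>i\<in>UNIV. 2 / lam $ i))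
      * (\<Prod>i\<in>UNIV. 2 / sqrt (lam $ i)) = e * (1 / sqrt pi) ^ CARD('m)"
proof -
  let ?V = "\<Prod>i\<in>UNIV. 2 / sqrt (lam $ i)"
  have V_pos: "0 < ?V"
    using assms by (intro prod_pos) auto
  have "(sqrt pi ^ CARD('m) * ?V)\<^sup>2 = (\<Prod>i\<in>(UNIV::'m set). (sqrt pi * (2 / sqrt (lam $ i)))\<^sup>2)"
    by (simp only: prod_power_distrib[symmetric] prod.distrib prod_constant)
  also have "\<dots> = (\<Prod>i\<in>UNIV. 2 * pi * (2 / lam $ i))"
    using assms by (intro prod.cong) (auto simp: power_mult_distrib power_divide less_imp_le)
  also have "\<dots> = (2 * pi) ^ CARD('m) * (\<Prod>i\<in>UNIV. 2 / lam $ i)"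
    by (simp only: prod.distrib prod_constant power_mult_distrib)
  finally have "(sqrt pi ^ CARD('m) * ?V)\<^sup>2 = (2 * pi) ^ CARD('m) * (\<Prod>i\<in>UNIV. 2 / lam $ i)" .
  then have eq: "sqrt ((2 * pi) ^ CARD('m) * (\<Prod>i\<in>UNIV. 2 / lam $ i)) = sqrt pi ^ CARD('m) * ?V"
    using V_pos by (intro real_sqrt_unique) (simp_all add: less_imp_le)
  show ?thesis
    using less_imp_neq[OF V_pos] unfolding eq
    by (simp add: power_divide nonzero_eq_divide_eq del: prod_dividef prod_eq_1_iff prod_zero_iff)
qed

section \<open>Divergence of the normalising constant\<close>

theorem proposition3p1:
  fixes x :: "'n::finite \<Rightarrow> real ^ 'p::finite"
    and y :: "real ^ 'n"
    and k :: "real \<Rightarrow> real ^ 'p \<Rightarrow> real ^ 'p \<Rightarrow> real"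
    and l :: "real \<Rightarrow> real \<Rightarrow> real"
    and C :: "real ^ 'n \<Rightarrow> real"
    and A c d u1 u2 :: real
  assumes y: "\<And>i. y $ i \<in> {0, 1}"
    and kernel: "\<And>\<theta>. \<theta> \<in> {u1<..<u2} \<Longrightarrow> reproducing_kernel (k \<theta>)"
    and kernel_measurable:
      "\<And>i j. (\<lambda>\<theta>. k \<theta> (x i) (x j)) \<in> borel_measurable (restrict_space borel {u1<..<u2})"
    and loss_measurable: "\<And>b. b \<in> {0, 1} \<Longrightarrow> l b \<in> borel_measurable borel"
    and C_measurable: "C \<in> borel_measurable borel"
    and C_pos: "\<And>z. 0 < C z"
    and A_pos: "0 < A"
    and hyper: "0 < c" "0 < d" "u1 < u2"
  shows
    "(\<integral>\<^sup>+\<theta>\<in>{u1<..<u2}.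
      (\<integral>\<^sup>+lam\<in>{lam :: real ^ ('n option). \<forall>i. 0 < lam $ i}.
       (\<integral>\<^sup>+\<sigma>2\<in>{0<..}.
        (\<integral>\<^sup>+z.
         (\<integral>\<^sup>+\<beta>.
            ennreal
              (likelihood C l y z
               * mvn_density (kernel_matrix (k \<theta>) x *v \<beta>) (\<sigma>2 *\<^sub>R mat 1) z
               * mvn_density 0 (\<sigma>2 *\<^sub>R matrix_inv (diag_matrix lam)) \<beta>
               * jeffreys_prior A lam
               * inverse_gamma_density c d \<sigma>2
               * uniform_density u1 u2 \<theta>)
          \<partial>lborel)
         \<partial>lborel)
        \<partial>lborel)
       \<partial>lborel)
      \<partial>lborel) = \<infinity>"
proof -
  have inner_top: "(\<integral>\<^sup>+lam\<in>{lam :: real ^ ('n option). \<forall>i. 0 < lam $ i}.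
       (\<integral>\<^sup>+\<sigma>2\<in>{0<..}.
        (\<integral>\<^sup>+z.
         (\<integral>\<^sup>+\<beta>.
            ennreal
              (likelihood C l y z
               * mvn_density (kernel_matrix (k \<theta>) x *v \<beta>) (\<sigma>2 *\<^sub>R mat 1) z
               * mvn_density 0 (\<sigma>2 *\<^sub>R matrix_inv (diag_matrix lam)) \<beta>
               * jeffreys_prior A lam
               * inverse_gamma_density c d \<sigma>2
               * uniform_density u1 u2 \<theta>)
          \<partial>lborel)
         \<partial>lborel)
        \<partial>lborel)
       \<partial>lborel) = \<infinity>" (is "?I = \<infinity>") if \<theta>: "\<theta> \<in> {u1<..<u2}" for \<theta>
  proof -
    let ?K = "kernel_matrix (k \<theta>) x :: real ^ ('n option) ^ 'n"
    define N where "N = CARD('n option)"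
    define P :: "real ^ ('n option) \<Rightarrow> real" where "P lam = (\<Prod>i\<in>UNIV. inverse (lam $ i))" for lam
    define w where "w = uniform_density u1 u2 \<theta>"
    define g where "g = d powr c / Gamma c * 2 powr (- c - 1) * exp (- d)"
    define b0 where "b0 = exp (- real N / 2) * (1 / sqrt pi) ^ N"
    have w: "0 < w"
      using \<theta> by (simp add: w_def uniform_density_def)
    have g: "0 < g"
      using hyper by (simp add: g_def)
    have b0: "0 < b0"
      by (simp add: b0_def)
    have L_pos: "0 < likelihood C l y z" for z
      using C_pos[of z] by (simp add: likelihood_def)

    \<comment> \<open>A bound for \<open>K\<beta>\<close> on the unit cube that is uniform in \<open>\<lambda>\<close>: every box used below lies there.\<close>
    obtain B where B: "\<And>\<beta>. norm (?K *v \<beta>) \<le> norm \<beta> * B" and "0 < B"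
      using bounded_linear.pos_bounded[OF matrix_vector_mul_bounded_linear[of ?K]] by auto
    define M where "M = real N * B"
    have M: "norm (?K *v \<beta>) \<le> M" if "\<And>i. \<bar>\<beta> $ i\<bar> \<le> 1" for \<beta>
    proof -
      have "norm \<beta> \<le> (\<Sum>i\<in>UNIV. \<bar>\<beta> $ i\<bar>)"
        by (rule norm_le_l1_cart)
      also have "\<dots> \<le> real N"
        using sum_mono[of UNIV "\<lambda>i. \<bar>\<beta> $ i\<bar>" "\<lambda>_. 1"] that by (simp add: N_def)
      finally show ?thesis
        using B[of \<beta>] \<open>0 < B\<close> unfolding M_def by (smt (verit) mult_right_mono)
    qed
    \<comment> \<open>For \<open>\<sigma>\<^sup>2 \<in> [1, 2]\<close> the exponent of the density of \<open>z\<close> is worst at \<open>\<sigma>\<^sup>2 = 1\<close> and its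
      normalisation at \<open>\<sigma>\<^sup>2 = 2\<close>. Combining both gives a minorant free of \<open>\<beta>\<close>, \<open>\<sigma>\<^sup>2\<close> and \<open>\<lambda>\<close>.\<close>
    define h :: "real ^ 'n \<Rightarrow> real" where
      "h z = exp (- (norm z + M)\<^sup>2 / 2) / sqrt ((2 * pi) ^ CARD('n) * (\<Prod>i\<in>(UNIV::'n set). 2))" for z
    have h_pos: "0 < h z" for z
      by (simp add: h_def)
    have h_le: "h z \<le> mvn_density (?K *v \<beta>) (s *\<^sub>R mat 1) z"
      if s: "s \<in> {1..2}" and \<beta>: "\<And>i. \<bar>\<beta> $ i\<bar> \<le> 1" for z \<beta> s
    proof -
      let ?\<mu> = "?K *v \<beta>"
      have "(\<Sum>i\<in>UNIV. (z $ i - ?\<mu> $ i)\<^sup>2 / s) \<le> (\<Sum>i\<in>UNIV. (z $ i - ?\<mu> $ i)\<^sup>2)"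
        using s by (intro sum_mono)
          (auto simp: pos_divide_le_eq intro!: mult_le_cancel_left1[THEN iffD2])
      also have "\<dots> = (norm (z - ?\<mu>))\<^sup>2"
        unfolding power2_norm_eq_inner inner_vec_def by (simp add: power2_eq_square)
      also have "norm (z - ?\<mu>) \<le> norm z + M"
        using M[OF \<beta>] norm_triangle_ineq4[of z ?\<mu>] by linarith
      then have "(norm (z - ?\<mu>))\<^sup>2 \<le> (norm z + M)\<^sup>2"
        by (intro power_mono) auto
      finally show ?thesis
        unfolding h_def mat_1_eq_diag_matrix scaleR_diag_matrix
        using s by (intro mvn_density_diag_matrix_ge) auto
    qed

    define J where "J = (\<integral>\<^sup>+z. ennreal (likelihood C l y z * h z) \<partial>lborel)"
    have loss_measurable': "(\<lambda>z. l (y $ i) (z $ i)) \<in> borel_measurable borel" for i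
      by (rule measurable_compose[OF _ loss_measurable[OF y]]) measurable
    have Lh_measurable: "(\<lambda>z. ennreal (likelihood C l y z * h z)) \<in> borel_measurable lborel"
      unfolding likelihood_def h_def using C_measurable loss_measurable' by measurable
    have J_pos: "J \<noteq> 0"
    proof
      assume "J = 0"
      then have "AE z in (lborel :: (real ^ 'n) measure). ennreal (likelihood C l y z * h z) = 0"
        using Lh_measurable unfolding J_def by (simp add: nn_integral_0_iff_AE)
      moreover have "ennreal (likelihood C l y z * h z) \<noteq> 0" for z
        using L_pos[of z] h_pos[of z] by (simp add: ennreal_eq_0_iff not_le)
      ultimately have "AE z in (lborel :: (real ^ 'n) measure). False"
        by simp
      then show False
        by (simp add: eventually_False ae_filter_eq_bot_iff)
    qed

    define G where "G = J * ennreal (b0 * A * g * w)"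
    have G_pos: "G \<noteq> 0"
      using J_pos b0 A_pos g w by (simp add: G_def ennreal_eq_0_iff not_le)

    \<comment> \<open>The marginal likelihood of \<open>\<lambda>\<close> is bounded below, so only the Jeffreys factor \<open>P lam\<close> depends
      on \<open>\<lambda>\<close> in the minorant.\<close>
    have marginal_ge: "G * ennreal (P lam) \<le> (\<integral>\<^sup>+\<sigma>2\<in>{0<..}.
        (\<integral>\<^sup>+z.
         (\<integral>\<^sup>+\<beta>.
            ennreal
              (likelihood C l y z
               * mvn_density (?K *v \<beta>) (\<sigma>2 *\<^sub>R mat 1) z
               * mvn_density 0 (\<sigma>2 *\<^sub>R matrix_inv (diag_matrix lam)) \<beta>
               * jeffreys_prior A lam
               * inverse_gamma_density c d \<sigma>2
               * uniform_density u1 u2 \<theta>)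
          \<partial>lborel)
         \<partial>lborel)
        \<partial>lborel)" (is "_ \<le> (\<integral>\<^sup>+\<sigma>2\<in>{0<..}. ?S \<sigma>2 \<partial>lborel)")
      if lam: "\<And>i. 1 \<le> lam $ i" for lam
    proof -
      have lam0: "0 < lam $ i" for i
        using lam[of i] by linarith
      have P: "0 < P lam"
        unfolding P_def using lam0 by (intro prod_pos) auto
      define box where "box = cbox (\<chi> i. - (1 / sqrt (lam $ i))) (\<chi> i. 1 / sqrt (lam $ i))"
      define b where "b = exp (- real N / 2) / sqrt ((2 * pi) ^ N * (\<Prod>i\<in>UNIV. 2 / lam $ i))"
      have "0 < (\<Prod>i\<in>UNIV. 2 / lam $ i)"
        using lam0 by (intro prod_pos) auto
      then have b_pos: "0 < b"
        by (simp add: b_def)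
      have vol: "emeasure lborel box = ennreal (\<Prod>i\<in>UNIV. 2 / sqrt (lam $ i))"
        unfolding box_def using lam0
        by (subst emeasure_lborel_cbox_cart) (auto intro: order_trans[of _ 0] less_imp_le)
      have b_vol: "b * (\<Prod>i\<in>UNIV. 2 / sqrt (lam $ i)) = b0"
        unfolding b_def b0_def N_def by (rule box_density_times_volume[OF lam0])
      have box_sqrt: "\<bar>\<beta> $ i\<bar> \<le> 1 / sqrt (lam $ i)" if "\<beta> \<in> box" for \<beta> i
        using that by (auto simp: box_def mem_box_cart abs_le_iff minus_le_iff)
      have box_1: "\<bar>\<beta> $ i\<bar> \<le> 1" if "\<beta> \<in> box" for \<beta> i
        using lam[of i] lam0[of i] by (intro order_trans[OF box_sqrt[OF that]]) simp
      have b_le: "b \<le> mvn_density 0 (s *\<^sub>R matrix_inv (diag_matrix lam)) \<beta>"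
        if s: "s \<in> {1..2}" and \<beta>: "\<beta> \<in> box" for s \<beta>
      proof -
        \<comment> \<open>Each term is at most \<open>1 / s\<close> on the box, and \<open>s \<ge> 1\<close>.\<close>
        have summand: "(\<beta> $ i)\<^sup>2 / (s / lam $ i) \<le> 1" for i
        proof -
          have "(\<beta> $ i)\<^sup>2 \<le> (1 / sqrt (lam $ i))\<^sup>2"
            using box_sqrt[OF \<beta>, of i] lam0[of i] by (simp add: abs_le_square_iff[symmetric])
          also have "\<dots> = 1 / lam $ i"
            using lam0[of i] by (simp add: power_divide)
          finally have "(\<beta> $ i)\<^sup>2 * lam $ i \<le> 1"
            using lam0[of i] by (simp add: field_simps)
          then show ?thesis
            using s by (simp add: field_simps)
        qed
        have "(\<Sum>i\<in>UNIV. (\<beta> $ i)\<^sup>2 / (s / lam $ i)) \<le> real N"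
          using sum_mono[of UNIV "\<lambda>i. (\<beta> $ i)\<^sup>2 / (s / lam $ i)" "\<lambda>_. 1"] summand
          by (simp add: N_def)
        then have "b \<le> mvn_density 0 (diag_matrix (\<chi> i. s / lam $ i)) \<beta>"
          unfolding b_def N_def using s lam0
          by (intro mvn_density_diag_matrix_ge)
            (auto intro!: divide_right_mono simp del: card_option simp: less_imp_le)
        moreover have "s *\<^sub>R matrix_inv (diag_matrix lam) = diag_matrix (\<chi> i. s / lam $ i)"
          using lam0 by (subst matrix_inv_diag_matrix)
            (auto simp: less_imp_neq[symmetric] scaleR_diag_matrix divide_inverse)
        ultimately show ?thesis
          by simp
      qed
      have S_ge: "G * ennreal (P lam) \<le> ?S s" if s: "s \<in> {1..2}" for s
      proof -
        have "ennreal (likelihood C l y z * h z) * ennreal (b0 * A * g * w * P lam) \<le>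
          (\<integral>\<^sup>+\<beta>. ennreal (likelihood C l y z
               * mvn_density (?K *v \<beta>) (s *\<^sub>R mat 1) z
               * mvn_density 0 (s *\<^sub>R matrix_inv (diag_matrix lam)) \<beta>
               * jeffreys_prior A lam
               * inverse_gamma_density c d s
               * uniform_density u1 u2 \<theta>) \<partial>lborel)" (is "_ \<le> (\<integral>\<^sup>+\<beta>. ?f \<beta> \<partial>lborel)") for z
        proof -
          let ?a = "likelihood C l y z * h z * b * (A * P lam) * g * w"
          have a: "0 \<le> ?a"
            using L_pos[of z] h_pos[of z] b_pos A_pos P g w by simp
          have "ennreal ?a * indicator box \<beta> \<le> ?f \<beta>" for \<beta>
          proof (cases "\<beta> \<in> box")
            case True
            have "?a \<le> likelihood C l y z
               * mvn_density (?K *v \<beta>) (s *\<^sub>R mat 1) z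
               * mvn_density 0 (s *\<^sub>R matrix_inv (diag_matrix lam)) \<beta>
               * jeffreys_prior A lam
               * inverse_gamma_density c d s
               * uniform_density u1 u2 \<theta>"
              unfolding w_def[symmetric] jeffreys_prior_def P_def[symmetric]
              using h_le[OF s box_1[OF True], of z] b_le[OF s True]
                inverse_gamma_density_ge[OF hyper(1,2) s, folded g_def]
                less_imp_le[OF L_pos[of z]] h_pos[of z] b_pos g w A_pos P
              by (intro mult_mono) (auto intro!: mult_nonneg_nonneg)
            then show ?thesis
              using True by (simp add: ennreal_leI)
          qed simp
          then have "(\<integral>\<^sup>+\<beta>. ennreal ?a * indicator box \<beta> \<partial>lborel) \<le> (\<integral>\<^sup>+\<beta>. ?f \<beta> \<partial>lborel)"
            by (intro nn_integral_mono)
          moreover have "(\<integral>\<^sup>+\<beta>. ennreal ?a * indicator box \<beta> \<partial>lborel) =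
              ennreal (likelihood C l y z * h z) * ennreal (b0 * A * g * w * P lam)"
          proof -
            have "(\<integral>\<^sup>+\<beta>. ennreal ?a * indicator box \<beta> \<partial>lborel) = ennreal ?a * emeasure lborel box"
              by (rule nn_integral_cmult_indicator) (simp add: box_def)
            also have "\<dots> = ennreal (?a * (\<Prod>i\<in>UNIV. 2 / sqrt (lam $ i)))"
              unfolding vol using a by (simp add: ennreal_mult')
            also have "?a * (\<Prod>i\<in>UNIV. 2 / sqrt (lam $ i)) =
                likelihood C l y z * h z * (b0 * A * g * w * P lam)"
              unfolding b_vol[symmetric] by (simp only: mult_ac)
            also have "ennreal \<dots> =
                ennreal (likelihood C l y z * h z) * ennreal (b0 * A * g * w * P lam)"
              using L_pos[of z] h_pos[of z] by (intro ennreal_mult') simp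
            finally show ?thesis .
          qed
          ultimately show ?thesis
            by simp
        qed
        then have "(\<integral>\<^sup>+z. ennreal (likelihood C l y z * h z)
            * ennreal (b0 * A * g * w * P lam) \<partial>lborel) \<le> ?S s"
          by (intro nn_integral_mono)
        moreover have "(\<integral>\<^sup>+z. ennreal (likelihood C l y z * h z)
            * ennreal (b0 * A * g * w * P lam) \<partial>lborel) = G * ennreal (P lam)"
          using Lh_measurable b0 A_pos g w P
          by (simp add: nn_integral_multc J_def[symmetric] G_def ennreal_mult mult.assoc)
        ultimately show ?thesis
          by simp
      qed
      have "G * ennreal (P lam) = (\<integral>\<^sup>+s. G * ennreal (P lam) * indicator {1..2::real} s \<partial>lborel)"
        by (subst nn_integral_cmult_indicator) auto
      also have "\<dots> \<le> (\<integral>\<^sup>+s\<in>{0<..}. ?S s \<partial>lborel)"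
        using S_ge by (intro nn_integral_mono) (auto simp: indicator_def)
      finally show ?thesis .
    qed

    have "(\<integral>\<^sup>+lam\<in>{lam :: real ^ ('n option). \<forall>i. 1 \<le> lam $ i}. ennreal (P lam) \<partial>lborel) = \<infinity>"
      unfolding P_def by (rule nn_integral_prod_inverse_eq_top)
    then have "\<infinity> = G * (\<integral>\<^sup>+lam. ennreal (P lam) * indicator {lam. \<forall>i. 1 \<le> lam $ i} lam \<partial>lborel)"
      using G_pos by (simp add: ennreal_mult_top)
    also have "\<dots> = (\<integral>\<^sup>+lam. G * (ennreal (P lam) * indicator {lam. \<forall>i. 1 \<le> lam $ i} lam) \<partial>lborel)"
      unfolding P_def by (intro nn_integral_cmult[symmetric]) measurable
    also have "\<dots> \<le> ?I"
    proof (intro nn_integral_mono)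
      fix lam :: "real ^ ('n option)"
      show "G * (ennreal (P lam) * indicator {lam. \<forall>i. 1 \<le> lam $ i} lam) \<le>
        (\<integral>\<^sup>+\<sigma>2\<in>{0<..}.
          (\<integral>\<^sup>+z.
           (\<integral>\<^sup>+\<beta>.
              ennreal
                (likelihood C l y z
                 * mvn_density (?K *v \<beta>) (\<sigma>2 *\<^sub>R mat 1) z
                 * mvn_density 0 (\<sigma>2 *\<^sub>R matrix_inv (diag_matrix lam)) \<beta>
                 * jeffreys_prior A lam
                 * inverse_gamma_density c d \<sigma>2
                 * uniform_density u1 u2 \<theta>)
            \<partial>lborel)
           \<partial>lborel)
          \<partial>lborel) * indicator {lam. \<forall>i. 0 < lam $ i} lam"
      proof (cases "\<forall>i. 1 \<le> lam $ i")
        case True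
        then have "\<forall>i. 0 < lam $ i"
          by (meson less_le_trans zero_less_one)
        then show ?thesis
          using marginal_ge[of lam] True by simp
      qed simp
    qed
    finally show ?thesis
      by (simp add: top_unique)
  qed
  \<comment> \<open>The integrand in \<open>\<theta>\<close> is infinite on an interval of positive length.\<close>
  have "(\<integral>\<^sup>+\<theta>. \<infinity> * indicator {u1<..<u2} \<theta> \<partial>lborel) = \<infinity> * emeasure lborel {u1<..<u2}"
    by (rule nn_integral_cmult_indicator) simp
  also have "\<dots> = \<infinity>"
    using hyper by (simp add: ennreal_top_mult ennreal_eq_0_iff)
  finally have "(\<integral>\<^sup>+\<theta>. \<infinity> * indicator {u1<..<u2} \<theta> \<partial>lborel) = \<infinity>" .
  then show ?thesis
    by (subst nn_integral_cong[where v = "\<lambda>\<theta>. \<infinity> * indicator {u1<..<u2} \<theta>"])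
      (use inner_top in \<open>auto simp: indicator_def\<close>)
qed

end
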